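(* Let $L$ be a $1$-compact, compactly generated multiplicative lattice in which the product of any two compact elements is compact, and suppose that $Z(L)$ is not an ideal of $L$. Then $1\le diam(\Gamma^m(L))\le 3$ and: (1) $diam(\Gamma^m(L))=1$ if and only if $L$ is reduced and $|(Z(L))^*|=|A(L)|=2$, where $A(L)$ is the set of atoms of $L$; (2) $diam(\Gamma^m(L))=2$ if and only if $L$ is reduced with exactly two minimal prime elements and $|(Z(L))^*|>2$; (3) $diam(\Gamma^m(L))=3$ if and only if $L$ is reduced with more than two minimal prime elements or $L$ is non-reduced.
   Context: A multiplicative lattice is a complete lattice $L$ (least element $0$, greatest element $1$) with a binary operation $\cdot$ that is commutative and associative and satisfies, for all $a,b,b_\alpha\in L$: $a\cdot(\bigvee_\alpha b_\alpha)=\bigvee_\alpha (a\cdot b_\alpha)$, $a\cdot b\le a\wedge b$, and $a\cdot 1=a$. It is reduced if $a^n=0$ for some positive integer $n$ implies $a=0$, and non-reduced otherwise. An element $c\in L$ is compact if $c\le\bigvee_\alpha a_\alpha$ implies $c\le\bigvee_{i=1}^n a_{\alpha_i}$ for some finite subfamily; $L$ is compactly generated if every element is a join of compact elements, and $1$-compact if $1$ is compact. An element $p\neq 1$ is prime if $a\cdot b\le p$ implies $a\le p$ or $b\le p$; a prime element is a minimal prime element if there is no prime element strictly below it. An ideal of $L$ is a non-empty subset closed downwards and under binary joins. $(Z(L))^*=\{x\in L: x\neq 0,\ x\cdot y=0\text{ for some }y\ne 0\text{ in }L\}$ and $Z(L)=(Z(L))^*\cup\{0\}$. The graph $\Gamma^m(L)$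 is the simple undirected graph with vertex set $(Z(L))^*$, two distinct vertices $a,b$ being adjacent iff $a\cdot b=0$. The diameter $diam(G)$ of a graph is $0$ if $G$ has one vertex and otherwise the supremum of the distances $d(x,y)$ (length of a shortest path, $\infty$ if none) over distinct vertices $x,y$. *)

theory Defs
  imports "Graph_Theory.Pair_Digraph" "HOL-Library.Extended_Nat"
begin

text \<open>The lattice constants \<open>0\<close> and \<open>1\<close> are \<open>bot\<close> and \<open>top\<close>; the unit of the monoid coincides
  with \<open>top\<close>, so that \<open>a * top = a\<close>. The family \<open>B\<close> in \<open>mult_Sup\<close> may be empty.\<close>

class multiplicative_lattice = complete_lattice + comm_monoid_mult +
  assumes one_eq_top: "1 = top"
    and mult_Sup: "a * Sup B = (SUP b\<in>B. a * b)"
    and mult_le_inf: "a * b \<le> inf a b"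

definition reduced :: "'a::multiplicative_lattice itself \<Rightarrow> bool" where
  "reduced _ \<longleftrightarrow> (\<forall>a::'a. (\<exists>n>0. a ^ n = bot) \<longrightarrow> a = bot)"

definition compact_element :: "'a::complete_lattice \<Rightarrow> bool" where
  "compact_element c \<longleftrightarrow> (\<forall>A. c \<le> Sup A \<longrightarrow> (\<exists>F\<subseteq>A. finite F \<and> c \<le> Sup F))"

definition compactly_generated :: "'a::complete_lattice itself \<Rightarrow> bool" where
  "compactly_generated _ \<longleftrightarrow> (\<forall>x::'a. \<exists>C. (\<forall>c\<in>C. compact_element c) \<and> x = Sup C)"

definition prime_element :: "'a::multiplicative_lattice \<Rightarrow> bool" where
  "prime_element p \<longleftrightarrow> p \<noteq> top \<and> (\<forall>a b. a * b \<le> p \<longrightarrow> a \<le> p \<or> b \<le> p)"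

definition minimal_primes :: "'a::multiplicative_lattice set" where
  "minimal_primes = {p. prime_element p \<and> \<not> (\<exists>q. prime_element q \<and> q < p)}"

definition atoms :: "'a::complete_lattice set" where
  "atoms = {a. a \<noteq> bot \<and> (\<forall>b. b < a \<longrightarrow> b = bot)}"

definition lattice_ideal :: "'a::lattice set \<Rightarrow> bool" where
  "lattice_ideal I \<longleftrightarrow> I \<noteq> {} \<and> (\<forall>x\<in>I. \<forall>y\<le>x. y \<in> I) \<and> (\<forall>x\<in>I. \<forall>y\<in>I. sup x y \<in> I)"

definition nonzero_zero_divisors :: "'a::multiplicative_lattice set" where
  "nonzero_zero_divisors = {x. x \<noteq> bot \<and> (\<exists>y. y \<noteq> bot \<and> x * y = bot)}"

definition zero_divisors :: "'a::multiplicative_lattice set" where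
  "zero_divisors = nonzero_zero_divisors \<union> {bot}"

text \<open>A simple undirected graph is a symmetric loop-free digraph without multiple arcs.\<close>

definition zero_divisor_graph :: "('a::multiplicative_lattice, 'a \<times> 'a) pre_digraph" where
  "zero_divisor_graph = with_proj
     \<lparr> pverts = nonzero_zero_divisors,
       parcs = {(a, b). a \<in> nonzero_zero_divisors \<and> b \<in> nonzero_zero_divisors
                        \<and> a \<noteq> b \<and> a * b = bot} \<rparr>"

lemma zero_divisor_graph_simple:
  "loopfree_digraph zero_divisor_graph" "nomulti_digraph zero_divisor_graph"
  "sym_digraph zero_divisor_graph"
  by (unfold_locales;
      auto simp: zero_divisor_graph_def with_proj_def arc_to_ends_def symmetric_conv mult.commute)+

text \<open>The infimum of the empty set is \<open>\<infinity>\<close>, which covers vertices not joined by a path.\<close>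

definition distance :: "('a, 'b) pre_digraph \<Rightarrow> 'a \<Rightarrow> 'a \<Rightarrow> enat" where
  "distance G u v = (INF p\<in>{p. pre_digraph.apath G u p v}. enat (length p))"

text \<open>The supremum of the empty set is \<open>0\<close>, which covers graphs with a single vertex.\<close>

definition diam :: "('a, 'b) pre_digraph \<Rightarrow> enat" where
  "diam G = (SUP (u, v)\<in>{(u, v). u \<in> verts G \<and> v \<in> verts G \<and> u \<noteq> v}. distance G u v)"

end

theory Submission
  imports Defs
begin

text \<open>
  Call a pair of vertices \<open>x\<close>, \<open>y\<close> dense if only \<open>bot\<close> annihilates both. Since the zero-divisors
  are closed downwards, their failure to form an ideal means that some \<open>sup x y\<close> is not a
  zero-divisor, and then \<open>x\<close>, \<open>y\<close> is a dense pair (\<open>dense_pair_if_not_ideal\<close>). Two vertices have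
  distance at most 2 iff their product is \<open>bot\<close> or they have a common nonzero annihilator
  (\<open>distance_le_2_iff\<close>), and all distances are at most 3 (\<open>distance_le_3\<close>). Hence, if the diameter
  is at most 2, every dense pair has product \<open>bot\<close> (\<open>dense_pair_mult_eq_bot\<close>). The forward
  direction of the classification comes from applying this rule not only to a given dense pair
  \<open>x\<close>, \<open>y\<close> but also to the pairs obtained from it by enlarging one component with an element
  that shares a nonzero annihilator with it.

  \<^item> Enlarging by an element \<open>q\<close> with \<open>q * q = bot\<close> forces \<open>q\<close> to annihilate both \<open>x\<close> and \<open>y\<close>, so
    \<open>q = bot\<close>: the lattice is reduced (\<open>diam_le_2_imp_reduced\<close>).
  \<^item> If \<open>x * a * b = bot\<close> with \<open>x * a\<close> and \<open>x * b\<close> both nonzero, then \<open>sup (x * a) y\<close> still forms a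
    dense pair with \<open>x\<close>, but the product of that pair is nonzero in a reduced lattice. So the
    annihilator of \<open>x\<close> is prime (\<open>prime_element_ann\<close>), and likewise that of \<open>y\<close>. These two primes
    have product \<open>bot\<close> and are incomparable, so they are exactly the minimal primes
    (\<open>minimal_primes_eq_ann\<close>).

  Conversely, compact generation and Zorn's lemma show that in a reduced lattice only \<open>bot\<close> lies
  below all minimal primes (\<open>minimal_prime_avoiding\<close>). If the minimal primes are just \<open>p\<close> and \<open>q\<close>,
  every vertex lies below one of them. Vertices below different ones are adjacent, and vertices
  below the same one are both adjacent to the other prime, so the diameter is at most 2
  (\<open>diam_le_2_if_two_minimal_primes\<close>). Thus diameter at most 2 means: reduced with exactly two
  minimal primes.

  A vertex adjacent to both members of a dense pair does not exist, so diameter 1 leaves only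
  the vertices \<open>x\<close> and \<open>y\<close>, which then are the two atoms. The three equivalences follow
  because the diameter is 1, 2 or 3.
\<close>

section \<open>Arithmetic in a multiplicative lattice\<close>

lemma mult_bot [simp]: "a * bot = (bot :: 'a::multiplicative_lattice)"
  using mult_Sup[of a "{}"] by simp

lemma bot_mult [simp]: "bot * a = (bot :: 'a::multiplicative_lattice)"
  by (metis mult_bot mult.commute)

lemma mult_sup_distrib:
  "a * sup b c = sup (a * b) (a * c)" for a :: "'a::multiplicative_lattice"
  using mult_Sup[of a "{b, c}"] by simp

lemma sup_mult_distrib:
  "sup b c * a = sup (b * a) (c * a)" for a :: "'a::multiplicative_lattice"
  by (metis mult_sup_distrib mult.commute)

lemma mult_le_left: "a * b \<le> a" for a :: "'a::multiplicative_lattice"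
  using mult_le_inf[of a b] by simp

lemma mult_le_right: "a * b \<le> b" for a :: "'a::multiplicative_lattice"
  using mult_le_inf[of a b] by simp

lemma mult_left_mono_lattice:
  "b \<le> c \<Longrightarrow> a * b \<le> a * c" for a :: "'a::multiplicative_lattice"
  by (metis mult_sup_distrib sup.absorb_iff2)

lemma mult_mono_lattice:
  "a \<le> c \<Longrightarrow> b \<le> d \<Longrightarrow> a * b \<le> c * d" for a :: "'a::multiplicative_lattice"
  by (metis mult_left_mono_lattice mult.commute order_trans)

lemma mult_eq_bot_mono:
  "a * c = bot \<Longrightarrow> b \<le> a \<Longrightarrow> b * c = bot" for a :: "'a::multiplicative_lattice"
  by (metis mult_mono_lattice order_refl le_bot)

definition ann :: "'a::multiplicative_lattice \<Rightarrow> 'a" where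
  "ann x = Sup {b. x * b = bot}"

lemma le_ann_iff: "b \<le> ann x \<longleftrightarrow> x * b = bot"
proof
  have "x * ann x = bot"
    by (auto simp: ann_def mult_Sup intro!: antisym SUP_least)
  then show "x * b = bot" if "b \<le> ann x"
    using that by (metis mult_eq_bot_mono mult.commute)
qed (auto simp: ann_def intro: Sup_upper)

lemma nonzero_zero_divisorI:
  fixes x y :: "'a::multiplicative_lattice"
  assumes "x \<noteq> bot" "y \<noteq> bot" "x * y = bot"
  shows "x \<in> nonzero_zero_divisors" "y \<in> nonzero_zero_divisors"
  using assms mult.commute[of x y] unfolding nonzero_zero_divisors_def by force+

lemma reduced_square:
  fixes a :: "'a::multiplicative_lattice"
  assumes "reduced TYPE('a)" and "a * a = bot"
  shows "a = bot"
proof -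
  have "a ^ 2 = bot" using assms(2) by (simp add: power2_eq_square)
  then show ?thesis using assms(1) unfolding reduced_def by (metis zero_less_numeral)
qed

text \<open>The witness is the last nonzero power of a nilpotent element.\<close>

lemma non_reduced_obtains_square_zero:
  assumes "\<not> reduced TYPE('a::multiplicative_lattice)"
  obtains q :: "'a::multiplicative_lattice" where "q \<noteq> bot" and "q * q = bot"
proof -
  obtain a :: 'a and n where a: "a \<noteq> bot" "n > 0" "a ^ n = bot"
    using assms unfolding reduced_def by blast
  define m where "m = (LEAST n. n > 0 \<and> a ^ n = bot)"
  have m: "m > 0" "a ^ m = bot"
    using LeastI[of "\<lambda>n. n > 0 \<and> a ^ n = bot" n] a by (auto simp: m_def)
  have "m \<noteq> 1" using m a by auto
  then have gt: "m - 1 > 0" using m by simp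
  have ne: "a ^ (m - 1) \<noteq> bot"
    using not_less_Least[of "m - 1" "\<lambda>n. n > 0 \<and> a ^ n = bot"] gt m by (simp add: m_def)
  have "(m - 1) + (m - 1) = m + (m - 2)" using gt by simp
  then have "a ^ (m - 1) * a ^ (m - 1) = a ^ m * a ^ (m - 2)"
    by (simp only: power_add[symmetric])
  then show thesis using that ne m by simp
qed

section \<open>Minimal primes of a reduced lattice\<close>

text \<open>Krull's argument: compactness of the powers of \<open>c\<close> lets Zorn's lemma produce an element
  maximal among those above no power of \<open>c\<close>. It is prime because strictly enlarging it in two
  ways yields two powers of \<open>c\<close>, whose product is again a power of \<open>c\<close>.\<close>

lemma prime_avoiding_powers:
  fixes c :: "'a::multiplicative_lattice"
  assumes comp: "\<And>n. compact_element (c ^ n)" and ne: "\<And>n. c ^ n \<noteq> bot"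
  obtains p where "prime_element p" and "\<not> c \<le> p"
proof -
  define S where "S = {x. \<forall>n. \<not> c ^ n \<le> x}"
  have "\<exists>m\<in>S. \<forall>a\<in>S. m \<le> a \<longrightarrow> a = m"
  proof (rule predicate_Zorn)
    show "partial_order_on S (relation_of (\<le>) S)"
      by (rule partial_order_on_relation_ofI) auto
    fix C assume C: "C \<in> Chains (relation_of (\<le>) S)"
    then have CS: "C \<subseteq> S" and chain: "\<And>a b. a \<in> C \<Longrightarrow> b \<in> C \<Longrightarrow> a \<le> b \<or> b \<le> a"
      by (auto simp: Chains_def relation_of_def)
    have sub: "F \<noteq> {} \<longrightarrow> Sup F \<in> F" if "finite F" "F \<subseteq> C" for F
      using that
    proof (induction F rule: finite_induct)
      case (insert x F)
      show ?case
      proof (cases "F = {}")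
        case False
        then have "Sup F \<in> F" "x \<le> Sup F \<or> Sup F \<le> x" using insert chain by auto
        then show ?thesis by (metis Sup_insert insertCI sup.absorb1 sup.absorb2)
      qed simp
    qed simp
    have "\<not> c ^ n \<le> Sup C" for n
    proof
      assume "c ^ n \<le> Sup C"
      then obtain F where F: "F \<subseteq> C" "finite F" "c ^ n \<le> Sup F"
        using comp unfolding compact_element_def by blast
      then have "F \<noteq> {}" using ne le_bot by fastforce
      then show False using sub F CS by (auto simp: S_def)
    qed
    then show "\<exists>u\<in>S. \<forall>a\<in>C. a \<le> u"
      by (auto simp: S_def intro: Sup_upper)
  qed
  then obtain p where p: "p \<in> S" and max: "\<And>a. a \<in> S \<Longrightarrow> p \<le> a \<Longrightarrow> a = p" by blast
  have power_le: "\<exists>n. c ^ n \<le> sup p a" if "\<not> a \<le> p" for a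
  proof (rule ccontr)
    assume "\<not> ?thesis"
    then have "sup p a = p" by (intro max) (auto simp: S_def)
    then show False using that by (metis sup.cobounded2)
  qed
  have "prime_element p"
    unfolding prime_element_def
  proof (intro conjI allI impI)
    show "p \<noteq> top" using p by (auto simp: S_def)
    fix a b assume ab: "a * b \<le> p"
    show "a \<le> p \<or> b \<le> p"
    proof (rule ccontr)
      assume "\<not> ?thesis"
      then obtain m n where "c ^ m \<le> sup p a" "c ^ n \<le> sup p b" using power_le by blast
      then have "c ^ (m + n) \<le> sup p a * sup p b"
        by (simp add: power_add mult_mono_lattice)
      also have "\<dots> \<le> p"
        using ab by (auto simp: mult_sup_distrib sup_mult_distrib mult_le_left mult_le_right)
      finally show False using p by (auto simp: S_def)
    qed
  qed
  moreover have "\<not> c \<le> p" using p power_one_right[of c] by (metis (mono_tags) S_def mem_Collect_eq)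
  ultimately show thesis by (rule that)
qed

text \<open>Zorn's lemma downwards: if \<open>a\<close> fails to lie below one member of a chain of primes and \<open>b\<close>
  fails to lie below another, then both fail at the smaller of the two. Hence the infimum of a
  nonempty chain of primes is prime.\<close>

lemma minimal_prime_below:
  fixes p :: "'a::multiplicative_lattice"
  assumes "prime_element p"
  obtains q where "q \<in> minimal_primes" and "q \<le> p"
proof -
  define P where "P = {q. prime_element q \<and> q \<le> p}"
  have "\<exists>m\<in>P. \<forall>a\<in>P. m \<ge> a \<longrightarrow> a = m"
  proof (rule predicate_Zorn)
    show "partial_order_on P (relation_of (\<ge>) P)"
      by (rule partial_order_on_relation_ofI) auto
    fix C assume "C \<in> Chains (relation_of (\<ge>) P)"
    then have CP: "C \<subseteq> P" and chain: "\<And>a b. a \<in> C \<Longrightarrow> b \<in> C \<Longrightarrow> a \<le> b \<or> b \<le> a"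
      by (auto simp: Chains_def relation_of_def)
    show "\<exists>u\<in>P. \<forall>a\<in>C. a \<ge> u"
    proof (cases "C = {}")
      case True
      then show ?thesis using assms by (auto simp: P_def)
    next
      case False
      then obtain r where r: "r \<in> C" by blast
      have "prime_element (Inf C)"
        unfolding prime_element_def
      proof (intro conjI allI impI)
        show "Inf C \<noteq> top"
          using r CP by (auto simp: P_def prime_element_def)
        fix a b assume ab: "a * b \<le> Inf C"
        show "a \<le> Inf C \<or> b \<le> Inf C"
        proof (rule ccontr)
          assume "\<not> ?thesis"
          then obtain s t where st: "s \<in> C" "t \<in> C" "\<not> a \<le> s" "\<not> b \<le> t"
            by (auto simp: le_Inf_iff)
          then obtain u where u: "u \<in> C" "\<not> a \<le> u" "\<not> b \<le> u"
            using chain[of s t] by (meson order_trans)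
          have "a * b \<le> u" using ab u by (meson Inf_lower order_trans)
          then show False using u CP by (auto simp: P_def prime_element_def)
        qed
      qed
      moreover have "Inf C \<le> p" using r CP by (auto simp: P_def intro: Inf_lower2)
      ultimately show ?thesis by (auto simp: P_def intro: Inf_lower)
    qed
  qed
  then obtain q where q: "q \<in> P" "\<And>a. a \<in> P \<Longrightarrow> a \<le> q \<Longrightarrow> a = q" by blast
  have "\<not> r < q" if "prime_element r" for r
    using q that by (force simp: P_def order_le_less)
  then show thesis
    using q by (intro that[of q]) (auto simp: P_def minimal_primes_def)
qed

text \<open>Any nonzero compact element below \<open>a\<close> has nonzero compact powers, so a prime avoiding it
  exists, and a minimal prime below that one avoids \<open>a\<close>.\<close>

lemma minimal_prime_avoiding:
  fixes a :: "'a::multiplicative_lattice"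
  assumes one_compact: "compact_element (top :: 'a)"
    and generated: "compactly_generated TYPE('a)"
    and mult_compact:
      "\<And>c d :: 'a. compact_element c \<Longrightarrow> compact_element d \<Longrightarrow> compact_element (c * d)"
    and red: "reduced TYPE('a)" and ne: "a \<noteq> bot"
  obtains p where "p \<in> minimal_primes" and "\<not> a \<le> p"
proof -
  obtain C where C: "\<forall>c\<in>C. compact_element c" "a = Sup C"
    using generated unfolding compactly_generated_def by blast
  then obtain c where c: "c \<in> C" "c \<noteq> bot" using ne by (metis Sup_bot_conv(1))
  then have ca: "c \<le> a" using C by (auto intro: Sup_upper)
  have "compact_element (c ^ n)" for n
    by (induction n) (use C c in \<open>auto simp: one_eq_top one_compact intro: mult_compact\<close>)
  moreover have "c ^ n \<noteq> bot" for n
  proof (cases "n = 0")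
    case True
    \<comment> \<open>The zeroth power is \<open>top\<close>, which is nonzero because \<open>a\<close> lies below it.\<close>
    then show ?thesis using ne top_greatest[of a] by (metis le_bot one_eq_top power_0)
  qed (use red c in \<open>auto simp: reduced_def\<close>)
  ultimately obtain p where p: "prime_element p" "\<not> c \<le> p"
    using prime_avoiding_powers by blast
  obtain q where "q \<in> minimal_primes" "q \<le> p" using minimal_prime_below p by blast
  then show thesis using p ca by (intro that[of q]) (auto dest: order_trans)
qed

section \<open>Distances in the zero-divisor graph\<close>

lemma zero_divisor_graph_sel [simp]:
  "verts zero_divisor_graph = nonzero_zero_divisors"
  "e \<in> arcs zero_divisor_graph \<longleftrightarrow>
    fst e \<in> nonzero_zero_divisors \<and> snd e \<in> nonzero_zero_divisors \<and>
    fst e \<noteq> snd e \<and> fst e * snd e = bot"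
  "tail zero_divisor_graph = fst"
  "head zero_divisor_graph = snd"
  by (auto simp: zero_divisor_graph_def)

text \<open>Distances are infima in the well-ordered extended naturals, so a finite distance is
  attained by an actual path.\<close>

lemma distance_le_enat_iff:
  "distance G u v \<le> enat n \<longleftrightarrow> (\<exists>p. pre_digraph.apath G u p v \<and> length p \<le> n)"
proof
  assume le: "distance G u v \<le> enat n"
  let ?D = "(\<lambda>p. enat (length p)) ` {p. pre_digraph.apath G u p v}"
  have "?D \<noteq> {}"
  proof
    assume "?D = {}"
    then have "distance G u v = top" by (simp only: distance_def Inf_empty)
    then show False using le by (simp add: top_enat_def)
  qed
  then have "Inf ?D \<in> ?D" by (metis LeastI equals0I Inf_enat_def)
  then show "\<exists>p. pre_digraph.apath G u p v \<and> length p \<le> n"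
    using le by (auto simp: distance_def)
qed (auto simp: distance_def intro: INF_lower2)

lemma diam_le_enat_iff:
  "diam G \<le> e \<longleftrightarrow>
    (\<forall>u v. u \<in> verts G \<longrightarrow> v \<in> verts G \<longrightarrow> u \<noteq> v \<longrightarrow> distance G u v \<le> e)"
  by (auto simp: diam_def SUP_le_iff)

lemma zero_divisor_apath_Nil_iff:
  "pre_digraph.apath zero_divisor_graph u [] v \<longleftrightarrow> u = v \<and> u \<in> nonzero_zero_divisors"
  by (auto simp: pre_digraph.apath_def pre_digraph.awalk_def pre_digraph.cas.simps
      pre_digraph.awalk_verts.simps)

lemma zero_divisor_apath_Cons_iff:
  "pre_digraph.apath zero_divisor_graph u (e # p) v \<longleftrightarrow>
    fst e = u \<and> u \<in> nonzero_zero_divisors \<and> u \<noteq> snd e \<and> u * snd e = bot \<and>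
    u \<notin> set (pre_digraph.awalk_verts zero_divisor_graph (snd e) p) \<and>
    pre_digraph.apath zero_divisor_graph (snd e) p v"
  by (auto simp: pre_digraph.apath_def pre_digraph.awalk_def pre_digraph.cas.simps
      pre_digraph.awalk_verts.simps)

lemmas zero_divisor_path_simps =
  zero_divisor_apath_Nil_iff zero_divisor_apath_Cons_iff pre_digraph.awalk_verts.simps

lemma distance_le_1_iff:
  fixes u v :: "'a::multiplicative_lattice"
  assumes "u \<in> nonzero_zero_divisors" "v \<in> nonzero_zero_divisors" "u \<noteq> v"
  shows "distance zero_divisor_graph u v \<le> 1 \<longleftrightarrow> u * v = bot"
proof
  assume "u * v = bot"
  then have "pre_digraph.apath zero_divisor_graph u [(u, v)] v"
    using assms by (simp add: zero_divisor_path_simps)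
  then show "distance zero_divisor_graph u v \<le> 1"
    unfolding one_enat_def distance_le_enat_iff by (intro exI[of _ "[(u, v)]"]) simp
next
  assume "distance zero_divisor_graph u v \<le> 1"
  then obtain p where "pre_digraph.apath zero_divisor_graph u p v" "length p \<le> 1"
    unfolding one_enat_def distance_le_enat_iff by blast
  then show "u * v = bot"
    using assms by (cases p) (auto simp: zero_divisor_path_simps)
qed

lemma distance_ge_1:
  assumes "u \<noteq> v"
  shows "1 \<le> distance zero_divisor_graph u v"
proof -
  have "\<not> distance zero_divisor_graph u v \<le> enat 0"
    using assms by (auto simp: distance_le_enat_iff zero_divisor_path_simps)
  then show ?thesis by (simp add: zero_enat_def[symmetric] one_eSuc ileI1)
qed

text \<open>The midpoint of a path of length 2 is a common annihilator. Conversely, a common nonzero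
  annihilator of two non-adjacent vertices differs from both, so it can serve as midpoint.\<close>

lemma distance_le_2_iff:
  fixes u v :: "'a::multiplicative_lattice"
  assumes "u \<in> nonzero_zero_divisors" "v \<in> nonzero_zero_divisors" "u \<noteq> v"
  shows "distance zero_divisor_graph u v \<le> 2 \<longleftrightarrow>
    u * v = bot \<or> (\<exists>w. w \<noteq> bot \<and> u * w = bot \<and> v * w = bot)"
    (is "_ \<longleftrightarrow> ?R")
proof
  assume "distance zero_divisor_graph u v \<le> 2"
  then obtain p where p: "pre_digraph.apath zero_divisor_graph u p v" "length p \<le> 2"
    unfolding numeral_eq_enat distance_le_enat_iff by blast
  show ?R
  proof (cases p)
    case (Cons e q)
    show ?thesis
    proof (cases q)
      case (Cons f r)
      then have "u * snd e = bot" "snd e * v = bot" "snd e \<in> nonzero_zero_divisors"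
        using p \<open>p = e # q\<close> by (auto simp: zero_divisor_path_simps)
      then show ?thesis by (auto simp: nonzero_zero_divisors_def mult.commute)
    qed (use p Cons in \<open>auto simp: zero_divisor_path_simps\<close>)
  qed (use p assms in \<open>auto simp: zero_divisor_path_simps\<close>)
next
  assume R: ?R
  show "distance zero_divisor_graph u v \<le> 2"
  proof (cases "u * v = bot")
    case True
    then have "distance zero_divisor_graph u v \<le> 1"
      using distance_le_1_iff assms by blast
    then show ?thesis by (rule order_trans) (simp add: one_enat_def numeral_eq_enat)
  next
    case False
    then obtain w where w: "w \<noteq> bot" "u * w = bot" "v * w = bot" using R by blast
    then have "w \<in> nonzero_zero_divisors" "w \<noteq> u" "w \<noteq> v"
      using False assms nonzero_zero_divisorI(2)[of u w]
      by (auto simp: nonzero_zero_divisors_def mult.commute)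
    then have "pre_digraph.apath zero_divisor_graph u [(u, w), (w, v)] v"
      using assms w by (auto simp: zero_divisor_path_simps mult.commute)
    then show ?thesis unfolding numeral_eq_enat distance_le_enat_iff by (intro exI[of _ "[(u, w), (w, v)]"]) simp
  qed
qed

text \<open>If \<open>a\<close> and \<open>b\<close> are annihilators of \<open>u\<close> and \<open>v\<close>, then \<open>a * b\<close> annihilates both. When the
  distance exceeds 2 this forces \<open>a * b = bot\<close>, and the path through \<open>a\<close> and \<open>b\<close> has
  length 3.\<close>

lemma distance_le_3:
  fixes u v :: "'a::multiplicative_lattice"
  assumes uv: "u \<in> nonzero_zero_divisors" "v \<in> nonzero_zero_divisors" "u \<noteq> v"
  shows "distance zero_divisor_graph u v \<le> 3"
proof (cases "distance zero_divisor_graph u v \<le> 2")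
  case True
  then show ?thesis by (rule order_trans) (simp add: numeral_eq_enat)
next
  case False
  then have ne: "u * v \<noteq> bot" and no: "\<And>w. u * w = bot \<Longrightarrow> v * w = bot \<Longrightarrow> w = bot"
    using distance_le_2_iff[OF uv] by blast+
  obtain a b where a: "a \<noteq> bot" "u * a = bot" and b: "b \<noteq> bot" "v * b = bot"
    using uv by (auto simp: nonzero_zero_divisors_def)
  have ab: "a * b = bot"
    using no[of "a * b"] a(2) b(2) mult.assoc[of u a b] mult.left_commute[of v a b] by simp
  have bv: "b * v = bot" using b(2) by (simp only: mult.commute[of b v])
  have va: "a * v \<noteq> bot" using a no[of a] by (metis mult.commute)
  have ub: "u * b \<noteq> bot" using b no[of b] by blast
  have "u \<noteq> a" using ab ub by blast
  moreover have "u \<noteq> b" using bv ne by blast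
  moreover have "a \<noteq> b" using a(2) ub by blast
  moreover have "a \<noteq> v" using a(2) ne by blast
  moreover have "b \<noteq> v" using ab va by blast
  moreover have "a \<in> nonzero_zero_divisors" "b \<in> nonzero_zero_divisors"
    using a(1) b(1) ab by (rule nonzero_zero_divisorI)+
  ultimately have "pre_digraph.apath zero_divisor_graph u [(u, a), (a, b), (b, v)] v"
    using uv a(2) ab bv by (simp add: zero_divisor_path_simps)
  then show ?thesis unfolding numeral_eq_enat distance_le_enat_iff
    by (intro exI[of _ "[(u, a), (a, b), (b, v)]"]) simp
qed

lemma diam_zero_divisor_graph_le_3:
  "diam (zero_divisor_graph :: ('a::multiplicative_lattice, _) pre_digraph) \<le> 3"
  using distance_le_3 by (auto simp: diam_le_enat_iff)

section \<open>Dense pairs of zero-divisors\<close>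

definition dense_pair :: "'a::multiplicative_lattice \<Rightarrow> 'a \<Rightarrow> bool" where
  "dense_pair x y \<longleftrightarrow> x \<in> nonzero_zero_divisors \<and> y \<in> nonzero_zero_divisors \<and>
    (\<forall>z. x * z = bot \<and> y * z = bot \<longrightarrow> z = bot)"

lemma dense_pair_vertices:
  assumes "dense_pair x y"
  shows "x \<in> nonzero_zero_divisors" "y \<in> nonzero_zero_divisors" "x \<noteq> bot" "y \<noteq> bot"
  using assms unfolding dense_pair_def nonzero_zero_divisors_def by blast+

lemma dense_pair_annihilator:
  "dense_pair x y \<Longrightarrow> x * z = bot \<Longrightarrow> y * z = bot \<Longrightarrow> z = bot"
  unfolding dense_pair_def by blast

lemma dense_pair_commute: "dense_pair x y \<longleftrightarrow> dense_pair y x"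
  unfolding dense_pair_def by blast

lemma dense_pair_neq: "dense_pair x y \<Longrightarrow> x \<noteq> y"
  unfolding dense_pair_def nonzero_zero_divisors_def by blast

text \<open>Enlarging a component keeps a pair dense as long as that component remains a zero-divisor,
  which the common annihilator \<open>w\<close> guarantees.\<close>

lemma dense_pair_sup_right:
  assumes xy: "dense_pair x y" and w: "w \<noteq> bot" "y * w = bot" "a * w = bot"
  shows "dense_pair x (sup a y)"
proof -
  have ne: "sup a y \<noteq> bot" using dense_pair_vertices(4)[OF xy] by (simp only: sup_eq_bot_iff) simp
  have "sup a y * w = bot" by (simp only: sup_mult_distrib w sup_bot_left)
  with ne w(1) have "sup a y \<in> nonzero_zero_divisors"
    by (rule nonzero_zero_divisorI(1))
  moreover have "z = bot" if "x * z = bot" "sup a y * z = bot" for z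
  proof (rule dense_pair_annihilator[OF xy that(1)])
    show "y * z = bot" using that(2) by (simp only: sup_mult_distrib sup_eq_bot_iff)
  qed
  ultimately show ?thesis
    using dense_pair_vertices(1)[OF xy] unfolding dense_pair_def by blast
qed

lemma dense_pair_if_not_ideal:
  assumes "\<not> lattice_ideal (zero_divisors :: 'a::multiplicative_lattice set)"
  obtains x y :: "'a::multiplicative_lattice" where "dense_pair x y"
proof -
  have down: "y \<in> zero_divisors" if "x \<in> zero_divisors" "y \<le> x" for x y :: 'a
    using that le_bot
    by (auto simp: zero_divisors_def nonzero_zero_divisors_def dest: mult_eq_bot_mono)
  have "zero_divisors \<noteq> ({} :: 'a set)" by (auto simp: zero_divisors_def)
  with assms down obtain x y :: 'a
    where xy: "x \<in> zero_divisors" "y \<in> zero_divisors" "sup x y \<notin> zero_divisors"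
    unfolding lattice_ideal_def by blast
  then have "x \<in> nonzero_zero_divisors" "y \<in> nonzero_zero_divisors"
    by (auto simp: zero_divisors_def)
  moreover have "z = bot" if "x * z = bot" "y * z = bot" for z
    using xy(3) that
    by (auto simp: zero_divisors_def nonzero_zero_divisors_def sup_mult_distrib)
  ultimately show thesis using that unfolding dense_pair_def by blast
qed

lemma dense_pair_diam_ge_1:
  fixes x y :: "'a::multiplicative_lattice"
  assumes "dense_pair x y"
  shows "1 \<le> diam (zero_divisor_graph :: ('a, _) pre_digraph)"
proof -
  have "distance zero_divisor_graph x y \<le> diam (zero_divisor_graph :: ('a, _) pre_digraph)"
    using dense_pair_vertices[OF assms] dense_pair_neq[OF assms]
      diam_le_enat_iff[of "zero_divisor_graph :: ('a, _) pre_digraph"] by auto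
  then show ?thesis using distance_ge_1 dense_pair_neq[OF assms] by (meson order_trans)
qed

lemma dense_pair_mult_eq_bot:
  fixes x y :: "'a::multiplicative_lattice"
  assumes diam: "diam (zero_divisor_graph :: ('a, _) pre_digraph) \<le> 2" and xy: "dense_pair x y"
  shows "x * y = bot"
proof -
  have "distance zero_divisor_graph x y \<le> 2"
    using diam dense_pair_vertices[OF xy] dense_pair_neq[OF xy] by (simp add: diam_le_enat_iff)
  then show ?thesis
    using distance_le_2_iff[of x y] dense_pair_vertices[OF xy] dense_pair_neq[OF xy]
      dense_pair_annihilator[OF xy] by blast
qed

text \<open>Suppose \<open>q * q = bot\<close> and \<open>d * q\<close> is nonzero for a dense pair \<open>c\<close>, \<open>d\<close>. Since \<open>c * d = bot\<close>, the
  element \<open>d * q\<close> annihilates both \<open>q\<close> and \<open>c\<close>, so \<open>d\<close>, \<open>sup q c\<close> is again a dense pair. Its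
  product should be \<open>bot\<close> but dominates \<open>d * q\<close>.\<close>

lemma diam_le_2_imp_reduced:
  fixes x y :: "'a::multiplicative_lattice"
  assumes diam: "diam (zero_divisor_graph :: ('a, _) pre_digraph) \<le> 2" and xy: "dense_pair x y"
  shows "reduced TYPE('a)"
proof (rule ccontr)
  assume "\<not> ?thesis"
  then obtain q :: 'a where q: "q \<noteq> bot" "q * q = bot"
    by (rule non_reduced_obtains_square_zero)
  have annihilates: "d * q = bot" if cd: "dense_pair c d" for c d :: 'a
  proof (rule ccontr)
    assume ne: "d * q \<noteq> bot"
    have "c * d = bot" using dense_pair_mult_eq_bot[OF diam cd] .
    then have "c * (d * q) = bot" by (simp flip: mult.assoc)
    moreover have "q * (d * q) = bot" using q by (simp add: mult.left_commute[of q d q])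
    ultimately have "dense_pair d (sup q c)"
      using ne cd by (metis dense_pair_sup_right dense_pair_commute)
    from dense_pair_mult_eq_bot[OF diam this] ne show False
      by (simp add: mult_sup_distrib)
  qed
  have "x * q = bot" "y * q = bot"
    using annihilates xy dense_pair_commute by blast+
  then show False using dense_pair_annihilator[OF xy] q by blast
qed

text \<open>If \<open>a * b\<close> annihilates \<open>x\<close> while neither \<open>a\<close> nor \<open>b\<close> does, then \<open>x * b\<close> is a common annihilator
  of \<open>x * a\<close> and \<open>y\<close>. So \<open>x\<close>, \<open>sup (x * a) y\<close> is a dense pair, and its product being \<open>bot\<close> makes
  the square of \<open>x * a\<close> vanish, against reducedness.\<close>

lemma prime_element_ann:
  fixes x y :: "'a::multiplicative_lattice"
  assumes diam: "diam (zero_divisor_graph :: ('a, _) pre_digraph) \<le> 2" and xy: "dense_pair x y"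
  shows "prime_element (ann x)"
  unfolding prime_element_def
proof (intro conjI allI impI)
  have red: "reduced TYPE('a)" using diam_le_2_imp_reduced[OF diam xy] .
  have xy0: "x * y = bot" using dense_pair_mult_eq_bot[OF diam xy] .
  show "ann x \<noteq> top"
  proof
    assume "ann x = top"
    then have "x * 1 = bot" unfolding one_eq_top by (metis le_ann_iff order_refl)
    then show False using dense_pair_vertices(3)[OF xy] by simp
  qed
  fix a b assume "a * b \<le> ann x"
  then have abx: "x * (a * b) = bot" by (simp add: le_ann_iff)
  show "a \<le> ann x \<or> b \<le> ann x"
  proof (rule ccontr)
    assume "\<not> ?thesis"
    then have ne: "x * a \<noteq> bot" "x * b \<noteq> bot" by (auto simp: le_ann_iff)
    have "(x * a) * (x * b) = x * (x * (a * b))" by (simp add: ac_simps)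
    moreover have "y * (x * b) = (x * y) * b" by (simp add: ac_simps)
    ultimately have "dense_pair x (sup (x * a) y)"
      using dense_pair_sup_right[OF xy ne(2)] abx xy0 by simp
    from dense_pair_mult_eq_bot[OF diam this] have "x * (x * a) = bot"
      by (simp add: mult_sup_distrib)
    then have "a * (x * (x * a)) = bot" by simp
    then have "(x * a) * (x * a) = bot" by (simp add: ac_simps)
    with reduced_square[OF red] ne show False by blast
  qed
qed

text \<open>The product of \<open>ann x\<close> and \<open>ann y\<close> annihilates \<open>x\<close> and \<open>y\<close>, hence is \<open>bot\<close>, so every prime lies
  above one of the two. They are incomparable: \<open>ann x \<le> ann y\<close> would put \<open>y\<close>, which annihilates
  \<open>x\<close>, below its own annihilator, and \<open>y\<close> would annihilate the whole pair.\<close>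

lemma minimal_primes_eq_ann:
  fixes x y :: "'a::multiplicative_lattice"
  assumes diam: "diam (zero_divisor_graph :: ('a, _) pre_digraph) \<le> 2" and xy: "dense_pair x y"
  shows "minimal_primes = {ann x, ann y}" and "ann x \<noteq> ann y"
proof -
  have yx: "dense_pair y x" using xy dense_pair_commute by blast
  note primes = prime_element_ann[OF diam xy] prime_element_ann[OF diam yx]
  have above: "ann x \<le> r \<or> ann y \<le> r" if "prime_element r" for r
  proof -
    have "x * (ann x * ann y) = bot" "y * (ann x * ann y) = bot"
      by (auto simp: le_ann_iff[symmetric] mult_le_left mult_le_right)
    then have "ann x * ann y = bot" by (rule dense_pair_annihilator[OF xy])
    then show ?thesis using that by (auto simp: prime_element_def)
  qed
  have incomp: "\<not> ann c \<le> ann d" if cd: "dense_pair c d" for c d :: 'a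
  proof
    assume "ann c \<le> ann d"
    moreover have "d \<le> ann c" using dense_pair_mult_eq_bot[OF diam cd] by (simp add: le_ann_iff)
    ultimately have "d \<le> ann d" by (rule order_trans[rotated])
    then have "c * d = bot" "d * d = bot"
      using \<open>d \<le> ann c\<close> by (simp_all add: le_ann_iff)
    then show False using dense_pair_annihilator[OF cd] dense_pair_vertices(4)[OF cd] by blast
  qed
  note incomp = incomp[OF xy] incomp[OF yx]
  then show "ann x \<noteq> ann y" by auto
  show "minimal_primes = {ann x, ann y}"
  proof
    show "minimal_primes \<subseteq> {ann x, ann y}"
      using above primes by (force simp: minimal_primes_def order_le_less)
    have "\<not> q < ann x" "\<not> q < ann y" if "prime_element q" for q
      using above[OF that] incomp by (meson leD less_imp_le order_trans)+
    then show "{ann x, ann y} \<subseteq> minimal_primes"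
      using primes by (auto simp: minimal_primes_def)
  qed
qed

text \<open>By \<open>avoid\<close> an element below both \<open>p\<close> and \<open>q\<close> is \<open>bot\<close>. A vertex lies below \<open>p\<close> or \<open>q\<close> because
  some nonzero annihilator of it does not lie below both; vertices below the same prime are
  annihilated by the other one.\<close>

lemma diam_le_2_if_two_minimal_primes:
  fixes p q :: "'a::multiplicative_lattice"
  assumes mp: "minimal_primes = {p, q}" "p \<noteq> q"
    and avoid: "\<And>a :: 'a. a \<noteq> bot \<Longrightarrow> \<exists>r\<in>minimal_primes. \<not> a \<le> r"
  shows "diam (zero_divisor_graph :: ('a, _) pre_digraph) \<le> 2"
proof -
  have zero: "a = bot" if "a \<le> p" "a \<le> q" for a using avoid[of a] that unfolding mp(1) by blast
  have prime: "prime_element p" "prime_element q" using mp by (auto simp: minimal_primes_def)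
  have incomp: "\<not> p \<le> q" "\<not> q \<le> p"
    using mp by (auto simp: minimal_primes_def order_le_less set_eq_iff)
  have pq: "u * v = bot" if "u \<le> p" "v \<le> q" for u v
    using that by (meson zero mult_le_left mult_le_right order_trans)
  have below: "u \<le> p \<or> u \<le> q" if "u \<in> nonzero_zero_divisors" for u
  proof -
    obtain w where "w \<noteq> bot" "u * w = bot" using \<open>u \<in> _\<close> by (auto simp: nonzero_zero_divisors_def)
    then show ?thesis using zero[of w] prime unfolding prime_element_def by (metis bot_least)
  qed
  have "distance zero_divisor_graph u v \<le> 2"
    if uv: "u \<in> nonzero_zero_divisors" "v \<in> nonzero_zero_divisors" "u \<noteq> v" for u v :: 'a
  proof -
    consider "u \<le> p" "v \<le> p" | "u \<le> q" "v \<le> q" | "u * v = bot"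
      using below[OF uv(1)] below[OF uv(2)] pq by (metis mult.commute)
    then show ?thesis
    proof cases
      case 1
      then have "u * q = bot" "v * q = bot" "q \<noteq> bot" using pq incomp by auto
      then show ?thesis using distance_le_2_iff[OF uv] by blast
    next
      case 2
      then have "u * p = bot" "v * p = bot" "p \<noteq> bot" using pq incomp by (auto simp: mult.commute)
      then show ?thesis using distance_le_2_iff[OF uv] by blast
    next
      case 3
      then show ?thesis using distance_le_2_iff[OF uv] by blast
    qed
  qed
  then show ?thesis by (auto simp: diam_le_enat_iff)
qed

text \<open>In a complete graph any further vertex would annihilate both members of the dense
  pair.\<close>

lemma vertices_eq_if_diam_le_1:
  fixes x y :: "'a::multiplicative_lattice"
  assumes diam: "diam (zero_divisor_graph :: ('a, _) pre_digraph) \<le> 1" and xy: "dense_pair x y"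
  shows "nonzero_zero_divisors = {x, y}"
proof -
  have prod: "u * v = bot"
    if "u \<in> nonzero_zero_divisors" "v \<in> nonzero_zero_divisors" "u \<noteq> v" for u v :: 'a
    using diam that distance_le_1_iff[OF that] by (auto simp: diam_le_enat_iff)
  have xy': "x \<in> nonzero_zero_divisors" "y \<in> nonzero_zero_divisors"
    using dense_pair_vertices[OF xy] by blast+
  have "u = x \<or> u = y" if "u \<in> nonzero_zero_divisors" for u
  proof (rule ccontr)
    assume "\<not> ?thesis"
    then have "x * u = bot" "y * u = bot" using prod xy' that by auto
    then have "u = bot" by (rule dense_pair_annihilator[OF xy])
    then show False using that by (simp add: nonzero_zero_divisors_def)
  qed
  then show ?thesis using xy' by auto
qed

text \<open>A nonzero element strictly below \<open>x\<close> is a vertex, hence equals \<open>y\<close>; but it is annihilated by \<open>y\<close>,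
  and \<open>y * y\<close> is nonzero. An atom \<open>w\<close> other than \<open>x\<close> and \<open>y\<close> would annihilate both of them, since
  the product of distinct atoms is \<open>bot\<close>.\<close>

lemma atoms_eq_if_two_vertices:
  fixes x y :: "'a::multiplicative_lattice"
  assumes red: "reduced TYPE('a)" and xy: "dense_pair x y" "x * y = bot"
    and Z: "nonzero_zero_divisors = {x, y}"
  shows "atoms = {x, y}"
proof -
  have atom: "c \<in> atoms" if cd: "dense_pair c d" "c * d = bot" "nonzero_zero_divisors = {c, d}"
    for c d :: 'a
  proof -
    have nz: "c \<noteq> bot" "d \<noteq> bot" using dense_pair_vertices[OF cd(1)] by blast+
    have "b = bot" if "b < c" for b
    proof (rule ccontr)
      assume b: "b \<noteq> bot"
      have "b * d = bot" using mult_eq_bot_mono[OF cd(2)] that by simp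
      then have "b \<in> nonzero_zero_divisors" using b nz by (metis nonzero_zero_divisorI(1))
      then have "b = d" using that cd(3) by auto
      then show False using \<open>b * d = bot\<close> reduced_square[OF red] nz by blast
    qed
    then show ?thesis using nz by (auto simp: atoms_def)
  qed
  have "{x, y} \<subseteq> atoms"
    using atom[OF xy Z] atom[of y x] xy Z by (auto simp: dense_pair_commute mult.commute insert_commute)
  moreover have "w = x \<or> w = y" if w: "w \<in> atoms" for w
  proof -
    have below: "w = c" if "w * c \<noteq> bot" "c \<in> atoms" for c
    proof -
      have "w * c = w" "w * c = c"
        using that w mult_le_left[of w c] mult_le_right[of w c] by (auto simp: atoms_def order_le_less)
      then show ?thesis by simp
    qed
    have "w \<noteq> bot" using w by (auto simp: atoms_def)
    then have "w * x \<noteq> bot \<or> w * y \<noteq> bot" using dense_pair_annihilator[OF xy(1)] by (metis mult.commute)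
    then show ?thesis using below \<open>{x, y} \<subseteq> atoms\<close> by auto
  qed
  ultimately show ?thesis by auto
qed

section \<open>Classification by diameter\<close>

lemma diam_le_1_if_two_vertices:
  fixes x y :: "'a::multiplicative_lattice"
  assumes Z: "nonzero_zero_divisors = {x, y}" and xy: "x * y = bot"
  shows "diam (zero_divisor_graph :: ('a, _) pre_digraph) \<le> 1"
proof -
  have "distance zero_divisor_graph u v \<le> 1"
    if uv: "u \<in> nonzero_zero_divisors" "v \<in> nonzero_zero_divisors" "u \<noteq> v" for u v :: 'a
    using distance_le_1_iff[OF uv] uv xy unfolding Z by (auto simp: mult.commute)
  then show ?thesis by (auto simp: diam_le_enat_iff)
qed

lemma reduced_two_vertices_mult_eq_bot:
  fixes x y :: "'a::multiplicative_lattice"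
  assumes red: "reduced TYPE('a)" and Z: "nonzero_zero_divisors = {x, y}"
  shows "x * y = bot"
proof -
  have "x \<in> nonzero_zero_divisors" unfolding Z by simp
  then obtain w where w: "x \<noteq> bot" "w \<noteq> bot" "x * w = bot" by (auto simp: nonzero_zero_divisors_def)
  then have "w \<in> nonzero_zero_divisors" by (metis nonzero_zero_divisorI(2))
  moreover have "w \<noteq> x" using w reduced_square[OF red] by blast
  ultimately show ?thesis using w unfolding Z by auto
qed

theorem theorem2p32:
  assumes one_compact: "compact_element (top :: 'a::multiplicative_lattice)"
    and compactly_generated: "compactly_generated TYPE('a)"
    and mult_compact:
      "\<And>c d :: 'a. compact_element c \<Longrightarrow> compact_element d \<Longrightarrow> compact_element (c * d)"
    and not_ideal: "\<not> lattice_ideal (zero_divisors :: 'a set)"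
  shows "1 \<le> diam (zero_divisor_graph :: ('a, 'a \<times> 'a) pre_digraph)
    \<and> diam (zero_divisor_graph :: ('a, 'a \<times> 'a) pre_digraph) \<le> 3
    \<and> (diam (zero_divisor_graph :: ('a, 'a \<times> 'a) pre_digraph) = 1 \<longleftrightarrow>
         reduced TYPE('a) \<and> card (nonzero_zero_divisors :: 'a set) = 2
         \<and> card (atoms :: 'a set) = 2)
    \<and> (diam (zero_divisor_graph :: ('a, 'a \<times> 'a) pre_digraph) = 2 \<longleftrightarrow>
         reduced TYPE('a) \<and> card (minimal_primes :: 'a set) = 2
         \<and> (infinite (nonzero_zero_divisors :: 'a set)
            \<or> card (nonzero_zero_divisors :: 'a set) > 2))
    \<and> (diam (zero_divisor_graph :: ('a, 'a \<times> 'a) pre_digraph) = 3 \<longleftrightarrow>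
         (reduced TYPE('a)
            \<and> (infinite (minimal_primes :: 'a set) \<or> card (minimal_primes :: 'a set) > 2))
         \<or> \<not> reduced TYPE('a))"
proof -
  let ?G = "zero_divisor_graph :: ('a, 'a \<times> 'a) pre_digraph"
  obtain x y :: 'a where xy: "dense_pair x y"
    using not_ideal by (rule dense_pair_if_not_ideal)
  have xyZ: "{x, y} \<subseteq> nonzero_zero_divisors" and "x \<noteq> y"
    using dense_pair_neq[OF xy] dense_pair_vertices[OF xy] by auto
  have ge1: "1 \<le> diam ?G" using dense_pair_diam_ge_1[OF xy] .
  have le3: "diam ?G \<le> 3" using diam_zero_divisor_graph_le_3 .
  have avoid: "\<exists>r\<in>minimal_primes. \<not> a \<le> r" if "reduced TYPE('a)" "a \<noteq> bot" for a :: 'a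
    using minimal_prime_avoiding[OF one_compact compactly_generated mult_compact that] by blast
  have le1: "diam ?G \<le> 1 \<longleftrightarrow>
      reduced TYPE('a) \<and> card (nonzero_zero_divisors :: 'a set) = 2" (is "_ \<longleftrightarrow> ?R1")
  proof
    assume le: "diam ?G \<le> 1"
    then have "diam ?G \<le> 2" by (rule order_trans) (simp add: one_enat_def numeral_eq_enat)
    then show ?R1
      using diam_le_2_imp_reduced xy \<open>x \<noteq> y\<close> unfolding vertices_eq_if_diam_le_1[OF le xy] by auto
  next
    assume R: ?R1
    then have "finite (nonzero_zero_divisors :: 'a set)" by (intro card_ge_0_finite) simp
    then have "{x, y} = nonzero_zero_divisors"
      using R xyZ \<open>x \<noteq> y\<close> by (intro card_subset_eq) auto
    then show "diam ?G \<le> 1"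
      using R reduced_two_vertices_mult_eq_bot diam_le_1_if_two_vertices by metis
  qed
  have le2: "diam ?G \<le> 2 \<longleftrightarrow>
      reduced TYPE('a) \<and> card (minimal_primes :: 'a set) = 2" (is "_ \<longleftrightarrow> ?R2")
  proof
    assume le: "diam ?G \<le> 2"
    show ?R2
      using minimal_primes_eq_ann(2)[OF le xy] diam_le_2_imp_reduced[OF le xy]
      unfolding minimal_primes_eq_ann(1)[OF le xy] by simp
  next
    assume R: ?R2
    then obtain p q :: 'a where "minimal_primes = {p, q}" "p \<noteq> q" by (auto simp: card_2_iff)
    then show "diam ?G \<le> 2" using diam_le_2_if_two_minimal_primes avoid R by blast
  qed
  have atoms: "card (atoms :: 'a set) = 2" if "diam ?G \<le> 1"
  proof -
    have red: "reduced TYPE('a)" using le1 that by blast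
    have Z: "nonzero_zero_divisors = {x, y}" using vertices_eq_if_diam_le_1[OF that xy] .
    have "atoms = {x, y}"
      using atoms_eq_if_two_vertices[OF red xy reduced_two_vertices_mult_eq_bot[OF red Z] Z] .
    then show ?thesis using \<open>x \<noteq> y\<close> by (metis card_2_iff)
  qed
  \<comment> \<open>A single minimal prime would contain \<open>x\<close> or an annihilator of \<open>x\<close>, although each is avoided by
     some minimal prime.\<close>
  have primes_ge2: "infinite (minimal_primes :: 'a set) \<or> card (minimal_primes :: 'a set) \<ge> 2"
    if red: "reduced TYPE('a)"
  proof (rule ccontr)
    assume "\<not> ?thesis"
    then have fin: "finite (minimal_primes :: 'a set)" "card (minimal_primes :: 'a set) \<le> Suc 0" by auto
    obtain w where w: "w \<noteq> bot" "x * w = bot" "x \<noteq> bot"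
      using xyZ by (auto simp: nonzero_zero_divisors_def)
    obtain r s where rs: "r \<in> minimal_primes" "\<not> x \<le> r" "s \<in> minimal_primes" "\<not> w \<le> s"
      using avoid[OF red] w by metis
    then have "r = s" using fin card_le_Suc0_iff_eq by blast
    moreover have "x * w \<le> r" using w by simp
    ultimately show False using rs by (auto simp: minimal_primes_def prime_element_def)
  qed
  have card_ge2: "infinite (nonzero_zero_divisors :: 'a set) \<or> card (nonzero_zero_divisors :: 'a set) \<ge> 2"
    using card_mono[OF _ xyZ] \<open>x \<noteq> y\<close> by auto
  obtain n where n: "diam ?G = enat n" using le3 by (cases "diam ?G") auto
  then have eqs: "diam ?G = 1 \<longleftrightarrow> diam ?G \<le> 1" "diam ?G = 2 \<longleftrightarrow> diam ?G \<le> 2 \<and> \<not> diam ?G \<le> 1"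
      "diam ?G = 3 \<longleftrightarrow> \<not> diam ?G \<le> 2"
    using ge1 le3 by (auto simp: one_enat_def numeral_eq_enat)
  have "diam ?G = 2 \<longleftrightarrow> reduced TYPE('a) \<and> card (minimal_primes :: 'a set) = 2
         \<and> (infinite (nonzero_zero_divisors :: 'a set)
            \<or> card (nonzero_zero_divisors :: 'a set) > 2)"
    unfolding eqs(2) le1 le2 using card_ge2 by auto
  moreover have "diam ?G = 3 \<longleftrightarrow>
         (reduced TYPE('a)
            \<and> (infinite (minimal_primes :: 'a set) \<or> card (minimal_primes :: 'a set) > 2))
         \<or> \<not> reduced TYPE('a)"
    unfolding eqs(3) le2 using primes_ge2 by auto
  moreover have "diam ?G = 1 \<longleftrightarrow> reduced TYPE('a) \<and> card (nonzero_zero_divisors :: 'a set) = 2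
         \<and> card (atoms :: 'a set) = 2"
    unfolding eqs(1) using le1 atoms by blast
  ultimately show ?thesis using ge1 le3 by blast
qed
end
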